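(* Let $n$ be a positive odd integer. Then, modulo $\Phi_n(q)$, \[ \sum_{k=0}^{n-1}\frac{(q;q^4)_k^2}{(q^4;q^4)_k^2}(-q)^{3k} \equiv\begin{cases} \dfrac{(q^5,q^7;q^8)_{(n-1)/8}}{(q^4;q^4)_{(n-1)/4}} &\text{if } n\equiv 1\pmod 8,\\[6pt] \dfrac{(q^5,q^7;q^8)_{(3n-1)/8}}{(q^4;q^4)_{(3n-1)/4}} &\text{if } n\equiv 3\pmod 8,\\[6pt] 0 &\text{if } n\equiv 5,7\pmod 8. \end{cases} \]
   Context: For an indeterminate $a$ and a nonnegative integer $k$, $(a;q)_k=\prod_{j=0}^{k-1}(1-aq^j)$, with $(a;q)_0=1$, and $(a_1,\dots,a_m;q)_k=(a_1;q)_k\cdots(a_m;q)_k$. $\Phi_n(q)=\prod_{1\le j\le n,\ \gcd(j,n)=1}(q-e^{2\pi i j/n})$ is the $n$-th cyclotomic polynomial. A congruence between rational functions in $q$ modulo a polynomial $P(q)$ means that the difference, written as a ratio of polynomials with denominator coprime to $P(q)$, has numerator divisible by $P(q)$. *)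

theory Defs
  imports Complex_Main "HOL-Computational_Algebra.Polynomial" "HOL-Computational_Algebra.Fraction_Field"
begin

definition qpoch :: "'a::comm_ring_1 \<Rightarrow> 'a \<Rightarrow> nat \<Rightarrow> 'a" where
  "qpoch a q k = (\<Prod>j<k. 1 - a * q ^ j)"

definition cyclotomic :: "nat \<Rightarrow> complex poly" where
  "cyclotomic n = (\<Prod>j\<in>{j. 1 \<le> j \<and> j \<le> n \<and> coprime j n}.
       [:- cis (2 * pi * real j / real n), 1:])"

definition qvar :: "complex poly fract" where
  "qvar = Fract [:0, 1:] 1"

definition cong_rf :: "complex poly \<Rightarrow> complex poly fract \<Rightarrow> complex poly fract \<Rightarrow> bool" where
  "cong_rf P x y \<longleftrightarrow> (\<exists>A B. B \<noteq> 0 \<and> coprime B P \<and> P dvd A \<and> x - y = Fract A B)"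

end

theory Submission
  imports Defs "HOL-Computational_Algebra.Polynomial_Factorial" "HOL-Computational_Algebra.Field_as_Ring"
begin

text \<open>
  Let \<open>z\<close> be a primitive \<open>n\<close>-th root of unity and \<open>p = z ^ 4\<close>. Choose \<open>N < n\<close> with \<open>z * p ^ N = 1\<close>,
  so that the sum terminates at \<open>N\<close>. By the \<open>q\<close>-binomial theorem, \<open>(z;p)\<^sub>k / (p;p)\<^sub>k\<close> is
  \<open>(- z) ^ k\<close> times the coefficient \<open>c\<^sub>k\<close> of \<open>x ^ k\<close> in \<open>(- x; p)\<^sub>N\<close>. The symmetry between \<open>c\<^sub>k\<close> and
  \<open>c\<^bsub>N - k\<^esub>\<close> turns the sum, up to a factor, into the coefficient of \<open>x ^ N\<close> in
  \<open>(x; p)\<^sub>N (- x; p)\<^sub>N = (x\<^sup>2; p\<^sup>2)\<^sub>N\<close>. This coefficient is zero for odd \<open>N\<close>, and is again given by the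
  \<open>q\<close>-binomial theorem for even \<open>N\<close>.
\<close>

section \<open>A terminating case of the \<open>q\<close>-Kummer sum\<close>

text \<open>This is \<open>(- a x; p)_N\<close> as a polynomial in \<open>x\<close>; its
  coefficients are Gaussian binomials up to powers of \<open>a\<close> and \<open>p\<close>.\<close>

definition qbinom_poly :: "'a::idom \<Rightarrow> 'a \<Rightarrow> nat \<Rightarrow> 'a poly" where
  "qbinom_poly p a N = (\<Prod>j<N. [:1, a * p ^ j:])"

text \<open>Substituting \<open>p x\<close> for \<open>x\<close> turns each factor into the next
  one, so only the first and the last factor of the product change.\<close>

lemma qbinom_poly_scale:
  "[:1, a:] * pcompose (qbinom_poly p a N) [:0, p:] = [:1, a * p ^ N:] * qbinom_poly p a N"
proof (induction N)
  case (Suc N)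
  let ?G = "qbinom_poly p a N" and ?L = "[:1, a * p ^ N:]" and ?L' = "[:1, a * p ^ Suc N:]"
  have "[:1, a:] * pcompose (qbinom_poly p a (Suc N)) [:0, p:]
      = [:1, a:] * pcompose ?G [:0, p:] * pcompose ?L [:0, p:]"
    by (simp only: qbinom_poly_def prod.lessThan_Suc pcompose_mult mult.assoc)
  also have "pcompose ?L [:0, p:] = ?L'"
    by (simp add: pcompose_pCons mult_ac)
  also have "[:1, a:] * pcompose ?G [:0, p:] * ?L' = ?L' * (?G * ?L)"
    by (simp only: Suc mult_ac)
  also have "?G * ?L = qbinom_poly p a (Suc N)"
    by (simp only: qbinom_poly_def prod.lessThan_Suc)
  finally show ?case .
qed (simp add: qbinom_poly_def pcompose_1)

text \<open>Compares coefficients in the functional equation. No division is made, so the recurrence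
  also holds when \<open>p\<close> is a root of unity.\<close>

lemma coeff_qbinom_poly_Suc:
  "coeff (qbinom_poly p a N) (Suc k) * (1 - p ^ Suc k)
    = a * coeff (qbinom_poly p a N) k * (p ^ k - p ^ N)"
proof -
  have "coeff ([:1, a:] * pcompose (qbinom_poly p a N) [:0, p:]) (Suc k)
      = coeff ([:1, a * p ^ N:] * qbinom_poly p a N) (Suc k)"
    by (simp only: qbinom_poly_scale)
  then show ?thesis
    by (simp add: coeff_pcompose_linear algebra_simps)
qed

lemma coeff_0_qbinom_poly [simp]: "coeff (qbinom_poly p a N) 0 = 1"
  by (simp add: qbinom_poly_def poly_prod flip: poly_0_coeff_0)

lemma coeff_top_qbinom_poly: "coeff (qbinom_poly p 1 N) N = (\<Prod>j<N. p ^ j)"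
proof -
  \<comment> \<open>The degree bound joins the induction because the coefficient one above the top
    of the previous product has to vanish.\<close>
  have "coeff (qbinom_poly p 1 N) N = (\<Prod>j<N. p ^ j) \<and> degree (qbinom_poly p 1 N) \<le> N"
  proof (induction N)
    case 0
    then show ?case by (simp add: qbinom_poly_def)
  next
    case (Suc N)
    have eq: "qbinom_poly p 1 (Suc N) = qbinom_poly p 1 N * [:1, p ^ N:]"
      by (simp add: qbinom_poly_def)
    have "degree (qbinom_poly p 1 (Suc N)) \<le> Suc N"
      unfolding eq using Suc degree_mult_le[of "qbinom_poly p 1 N" "[:1, p ^ N:]"]
      by (simp split: if_splits)
    moreover have "coeff (qbinom_poly p 1 N) (Suc N) = 0"
      using Suc by (simp add: coeff_eq_0)
    ultimately show ?case
      using Suc by (simp add: eq algebra_simps)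
  qed
  then show ?thesis by simp
qed

text \<open>The \<open>q\<close>-binomial theorem with cleared denominators, obtained by iterating
  the recurrence.\<close>

lemma coeff_qbinom_poly_mult_qpoch:
  "coeff (qbinom_poly p a N) k * qpoch p p k = a ^ k * (\<Prod>j<k. p ^ j - p ^ N)"
proof (induction k)
  case 0
  then show ?case by (simp add: qpoch_def)
next
  case (Suc k)
  have "coeff (qbinom_poly p a N) (Suc k) * qpoch p p (Suc k)
      = coeff (qbinom_poly p a N) (Suc k) * (1 - p ^ Suc k) * qpoch p p k"
    by (simp add: qpoch_def)
  also have "\<dots> = a * (p ^ k - p ^ N) * (coeff (qbinom_poly p a N) k * qpoch p p k)"
    unfolding coeff_qbinom_poly_Suc by (simp add: mult_ac)
  finally show ?case
    unfolding Suc by (simp add: mult_ac)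
qed

lemma coeff_qbinom_poly_minus:
  "coeff (qbinom_poly p (- a) N) k = (- 1) ^ k * coeff (qbinom_poly p a N) k"
proof -
  have "qbinom_poly p (- a) N = pcompose (qbinom_poly p a N) [:0, - 1:]"
    by (simp add: qbinom_poly_def pcompose_prod pcompose_pCons)
  then show ?thesis
    by (simp add: coeff_pcompose_linear)
qed

text \<open>Factor by factor this is the difference of squares
  \<open>(1 + p^j x)(1 - p^j x) = 1 - p^(2j) x^2\<close>.\<close>

lemma qbinom_poly_mult_minus:
  "qbinom_poly p 1 N * qbinom_poly p (- 1) N = pcompose (qbinom_poly (p\<^sup>2) (- 1) N) [:0, 0, 1:]"
  by (simp add: qbinom_poly_def pcompose_prod pcompose_pCons flip: prod.distrib power_mult)
    (simp add: power2_eq_square power_mult_distrib flip: power_mult power_add mult_2)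

lemma coeff_pcompose_square:
  "coeff (pcompose f [:0, 0, 1:]) m = (if even m then coeff f (m div 2) else (0::'a::comm_ring_1))"
proof (induction f arbitrary: m)
  case (pCons a f)
  show ?case
  proof (cases m)
    case (Suc k)
    then show ?thesis
      using pCons.IH by (cases k) (auto simp: pcompose_pCons)
  qed (simp add: pcompose_pCons)
qed simp

section \<open>Nonvanishing and parity splitting of products\<close>

lemma qpoch_nonzero:
  fixes p :: "'a::field"
  assumes "\<And>j. 1 \<le> j \<Longrightarrow> j \<le> k \<Longrightarrow> p ^ j \<noteq> 1"
  shows "qpoch p p k \<noteq> 0"
  using assms[of "Suc _"] by (auto simp: qpoch_def)

lemma qpoch_even_split: "qpoch p p (2 * M) = qpoch p (p\<^sup>2) M * qpoch (p\<^sup>2) (p\<^sup>2) M"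
proof (induction M)
  case (Suc M)
  have "qpoch p p (2 * Suc M)
      = qpoch p p (2 * M) * (1 - p * (p\<^sup>2) ^ M) * (1 - p\<^sup>2 * (p\<^sup>2) ^ M)"
    by (simp add: qpoch_def power_mult power_mult_distrib power2_eq_square mult_ac)
  then show ?case
    unfolding Suc by (simp add: qpoch_def mult_ac)
qed (simp add: qpoch_def)

lemma prod_lessThan_even_split:
  "(\<Prod>j<2 * M. f j) = (\<Prod>j<M. f (2 * j)) * (\<Prod>j<M. f (2 * j + 1))"
  for f :: "nat \<Rightarrow> 'a::comm_monoid_mult"
  by (induction M) (simp_all add: mult_ac)

section \<open>Evaluation of the sum when \<open>q\<close> is the inverse of
  \<open>p ^ N\<close>\<close>

context
  fixes p q :: "'a::field" and N :: nat
  assumes pnz: "p \<noteq> 0"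
    and order: "\<And>j. 1 \<le> j \<Longrightarrow> j \<le> N \<Longrightarrow> p ^ j \<noteq> 1"
    and qp: "q * p ^ N = 1"
begin

text \<open>Since \<open>q * p ^ N = 1\<close>, each factor satisfies
  \<open>- q * (p ^ j - p ^ N) = 1 - q * p ^ j\<close>.\<close>

lemma qpoch_ratio_eq_coeff:
  assumes "k \<le> N"
  shows "qpoch q p k / qpoch p p k = (- q) ^ k * coeff (qbinom_poly p 1 N) k"
proof -
  have "(- q) ^ k * (\<Prod>j<k. p ^ j - p ^ N) = (\<Prod>j<k. (- q) * (p ^ j - p ^ N))"
    by (simp only: prod.distrib prod_constant card_lessThan)
  also have "\<dots> = qpoch q p k"
    unfolding qpoch_def using qp by (intro prod.cong) (auto simp: algebra_simps)
  finally have "(- q) ^ k * (coeff (qbinom_poly p 1 N) k * qpoch p p k) = qpoch q p k"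
    by (simp add: coeff_qbinom_poly_mult_qpoch)
  moreover have "qpoch p p k \<noteq> 0"
    using assms order by (intro qpoch_nonzero) auto
  ultimately show ?thesis
    by (simp add: field_simps)
qed

text \<open>This is the symmetry of the Gaussian binomials; the powers of \<open>p\<close> it
  produces are rewritten through \<open>q\<close>.\<close>

lemma coeff_qbinom_poly_symmetry:
  assumes "k \<le> N"
  shows "coeff (qbinom_poly p 1 N) (N - k)
    = coeff (qbinom_poly p 1 N) N * (q * p) ^ k * coeff (qbinom_poly p 1 N) k"
  using assms
proof (induction k)
  case 0
  then show ?case by simp
next
  case (Suc k)
  define m where "m = N - Suc k"
  let ?c = "coeff (qbinom_poly p 1 N)"
  have N: "N = Suc (m + k)" and Nk: "N - k = Suc m"
    using Suc by (auto simp: m_def)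
  have IH: "?c (Suc m) = ?c N * (q * p) ^ k * ?c k"
    using Suc Nk by simp
  \<comment> \<open>As \<open>m + k + 1 = N\<close>, the recurrences at \<open>m\<close> and at
    \<open>k\<close> involve the same two factors \<open>1 - p ^ Suc m\<close> and
    \<open>1 - p ^ Suc k\<close>, in exchanged roles.\<close>
  have m: "?c (Suc m) * (1 - p ^ Suc m) = ?c m * p ^ m * (1 - p ^ Suc k)"
    using coeff_qbinom_poly_Suc[of p 1 N m] by (simp add: N power_add algebra_simps)
  have k: "?c (Suc k) * (1 - p ^ Suc k) = ?c k * p ^ k * (1 - p ^ Suc m)"
    using coeff_qbinom_poly_Suc[of p 1 N k] by (simp add: N power_add algebra_simps)
  have nz: "1 - p ^ Suc k \<noteq> 0"
    using order[of "Suc k"] Suc by simp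
  have "?c m * p ^ m * p ^ k * (1 - p ^ Suc k) = ?c (Suc m) * (1 - p ^ Suc m) * p ^ k"
    unfolding m by (simp only: mult_ac)
  also have "\<dots> = ?c N * (q * p) ^ k * (?c k * p ^ k * (1 - p ^ Suc m))"
    unfolding IH by (simp only: mult_ac)
  also have "\<dots> = ?c N * (q * p) ^ k * ?c (Suc k) * (1 - p ^ Suc k)"
    unfolding k[symmetric] by (simp only: mult_ac)
  finally have eq: "?c m * p ^ m * p ^ k = ?c N * (q * p) ^ k * ?c (Suc k)"
    using nz by simp
  \<comment> \<open>Inserting \<open>q * p ^ N = 1\<close> supplies exactly the power
    \<open>p ^ m * p ^ k\<close> needed for \<open>eq\<close>, with one \<open>q * p\<close> left
    over.\<close>
  have "?c m = ?c m * (q * p ^ N)"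
    by (simp add: qp)
  also have "\<dots> = (?c m * p ^ m * p ^ k) * (q * p)"
    by (simp add: N power_add mult_ac)
  also have "\<dots> = ?c N * (q * p) ^ Suc k * ?c (Suc k)"
    unfolding eq by (simp add: mult_ac)
  finally show ?case
    by (simp add: m_def)
qed

text \<open>The two ratios and the weight give \<open>(- q) ^ (5 * k)\<close>, which is
  \<open>(- 1) ^ k * (q * p) ^ k\<close> because \<open>q ^ 4 = p\<close>. The sign turns one
  \<open>?c k\<close> into a coefficient for \<open>- 1\<close>, and \<open>(q * p) ^ k\<close>
  turns the other into \<open>?c (N - k)\<close>, so the sum is a convolution.\<close>

lemma qKummer_sum_eq_coeff:
  assumes "q ^ 4 = p"
  shows "(\<Sum>k\<le>N. (qpoch q p k)\<^sup>2 / (qpoch p p k)\<^sup>2 * (- q) ^ (3 * k)) * (\<Prod>j<N. p ^ j)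
    = coeff (pcompose (qbinom_poly (p\<^sup>2) (- 1) N) [:0, 0, 1:]) N"
proof -
  let ?c = "coeff (qbinom_poly p 1 N)"
  have "(qpoch q p k)\<^sup>2 / (qpoch p p k)\<^sup>2 * (- q) ^ (3 * k) * ?c N
      = coeff (qbinom_poly p (- 1) N) k * ?c (N - k)" if "k \<le> N" for k
  proof -
    have "(qpoch q p k)\<^sup>2 / (qpoch p p k)\<^sup>2 * (- q) ^ (3 * k) * ?c N
        = ((- q) ^ k * ?c k)\<^sup>2 * ((- q) ^ 3) ^ k * ?c N"
      by (simp only: qpoch_ratio_eq_coeff[OF that] power_mult flip: power_divide)
    also have "\<dots> = ((- q) ^ 5) ^ k * (?c k)\<^sup>2 * ?c N"
    proof -
      have "(r ^ k)\<^sup>2 * (r ^ 3) ^ k = (r ^ 5) ^ k" for r :: 'a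
        by (simp add: mult_ac flip: power_mult power_add)
      note this[of "- q", symmetric]
      then show ?thesis
        by (simp only: power_mult_distrib mult_ac)
    qed
    also have "(- q) ^ 5 = - 1 * (q * p)"
      by (simp add: assms[symmetric] numeral_eq_Suc)
    finally show ?thesis
      unfolding coeff_qbinom_poly_minus coeff_qbinom_poly_symmetry[OF that] power_mult_distrib
      by (simp add: power2_eq_square mult_ac)
  qed
  then have "(\<Sum>k\<le>N. (qpoch q p k)\<^sup>2 / (qpoch p p k)\<^sup>2 * (- q) ^ (3 * k)) * ?c N
      = coeff (qbinom_poly p (- 1) N * qbinom_poly p 1 N) N"
    by (simp add: sum_distrib_right coeff_mult)
  then show ?thesis
    by (simp add: coeff_top_qbinom_poly qbinom_poly_mult_minus mult.commute)
qed

lemma prod_powers_nonzero: "(\<Prod>j<k. p ^ j) \<noteq> 0"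
  using pnz by simp

lemma qKummer_sum_odd:
  assumes "q ^ 4 = p" "odd N"
  shows "(\<Sum>k\<le>N. (qpoch q p k)\<^sup>2 / (qpoch p p k)\<^sup>2 * (- q) ^ (3 * k)) = 0"
proof -
  have "(\<Sum>k\<le>N. (qpoch q p k)\<^sup>2 / (qpoch p p k)\<^sup>2 * (- q) ^ (3 * k)) * (\<Prod>j<N. p ^ j) = 0"
    unfolding qKummer_sum_eq_coeff[OF assms(1)] using assms(2) by (simp add: coeff_pcompose_square)
  then show ?thesis
    unfolding mult_eq_0_iff using prod_powers_nonzero by blast
qed

text \<open>Reversing \<open>(p; p^2)_M\<close> and using \<open>q = p^(-2M)\<close> produces the
  factor \<open>(q p; p^2)_M\<close> of the closed form, at the cost of odd powers of
  \<open>p\<close> and one sign per factor.\<close>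

lemma qpoch_reverse_odd:
  assumes N: "N = 2 * M"
  shows "(\<Prod>j<M. p ^ (2 * j + 1)) * qpoch (q * p) (p\<^sup>2) M = (- 1) ^ M * qpoch p (p\<^sup>2) M"
proof -
  have "(\<Prod>j<M. p ^ (2 * j + 1)) = (\<Prod>j<M. p ^ (2 * (M - Suc j) + 1))"
    by (subst prod.nat_diff_reindex) simp
  then have "(\<Prod>j<M. p ^ (2 * j + 1)) * qpoch (q * p) (p\<^sup>2) M
      = (\<Prod>j<M. p ^ (2 * (M - Suc j) + 1) * (1 - q * p * (p\<^sup>2) ^ j))"
    by (simp add: qpoch_def prod.distrib)
  also have "\<dots> = (\<Prod>j<M. - 1 * (1 - p * (p\<^sup>2) ^ (M - Suc j)))"
  proof (rule prod.cong)
    fix j assume "j \<in> {..<M}"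
    then have "2 * (M - Suc j) + 1 + 1 + 2 * j = N"
      using N by auto
    then have "p ^ (2 * (M - Suc j) + 1) * p * (p\<^sup>2) ^ j = p ^ N"
      by (metis power_add power_mult power_one_right)
    then have "p ^ (2 * (M - Suc j) + 1) * (q * p * (p\<^sup>2) ^ j) = 1"
      using qp by (metis mult.assoc mult.commute)
    then show "p ^ (2 * (M - Suc j) + 1) * (1 - q * p * (p\<^sup>2) ^ j)
        = - 1 * (1 - p * (p\<^sup>2) ^ (M - Suc j))"
      by (simp add: right_diff_distrib power_mult)
  qed simp
  also have "\<dots> = (- 1) ^ M * (\<Prod>j<M. 1 - p * (p\<^sup>2) ^ (M - Suc j))"
    unfolding prod.distrib by simp
  also have "(\<Prod>j<M. 1 - p * (p\<^sup>2) ^ (M - Suc j)) = qpoch p (p\<^sup>2) M"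
    unfolding qpoch_def by (rule prod.nat_diff_reindex)
  finally show ?thesis .
qed

text \<open>After \<open>p ^ (2 * j)\<close> is taken out, the remaining exponents
  \<open>2 * N - 2 * j\<close> run downwards to \<open>N + 2\<close>; reading them backwards gives a
  shifted factorial.\<close>

lemma prod_diff_eq_qpoch:
  assumes N: "N = 2 * M"
  shows "(\<Prod>j<M. (p\<^sup>2) ^ j - (p\<^sup>2) ^ N) = (\<Prod>j<M. p ^ (2 * j)) * qpoch (p ^ (N + 2)) (p\<^sup>2) M"
proof -
  have "(\<Prod>j<M. (p\<^sup>2) ^ j - (p\<^sup>2) ^ N)
      = (\<Prod>j<M. p ^ (2 * j) * (1 - p ^ (N + 2) * (p\<^sup>2) ^ (M - Suc j)))"
  proof (rule prod.cong)
    fix j assume "j \<in> {..<M}"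
    then have "2 * j + (N + 2) + 2 * (M - Suc j) = 2 * N"
      using N by auto
    then have "p ^ (2 * j) * (p ^ (N + 2) * (p\<^sup>2) ^ (M - Suc j)) = (p\<^sup>2) ^ N"
      by (metis power_add power_mult mult.assoc)
    then show "(p\<^sup>2) ^ j - (p\<^sup>2) ^ N = p ^ (2 * j) * (1 - p ^ (N + 2) * (p\<^sup>2) ^ (M - Suc j))"
      by (simp add: right_diff_distrib power_mult)
  qed simp
  also have "\<dots> = (\<Prod>j<M. p ^ (2 * j)) * (\<Prod>j<M. 1 - p ^ (N + 2) * (p\<^sup>2) ^ (M - Suc j))"
    by (rule prod.distrib)
  also have "(\<Prod>j<M. 1 - p ^ (N + 2) * (p\<^sup>2) ^ (M - Suc j)) = qpoch (p ^ (N + 2)) (p\<^sup>2) M"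
    unfolding qpoch_def by (rule prod.nat_diff_reindex)
  finally show ?thesis .
qed

lemma qKummer_sum_even:
  assumes "q ^ 4 = p" and N: "N = 2 * M"
  shows "(\<Sum>k\<le>N. (qpoch q p k)\<^sup>2 / (qpoch p p k)\<^sup>2 * (- q) ^ (3 * k))
    = qpoch (q * p) (p\<^sup>2) M * qpoch (p ^ (N + 2)) (p\<^sup>2) M / qpoch p p N" (is "?S = _")
proof -
  let ?E = "\<Prod>j<M. p ^ (2 * j)" and ?O = "\<Prod>j<M. p ^ (2 * j + 1)"
  let ?c = "coeff (qbinom_poly (p\<^sup>2) (- 1) N) M"
  have nz: "?E * ?O \<noteq> 0"
    using pnz by simp
  have nz': "qpoch p p N \<noteq> 0"
    using order by (intro qpoch_nonzero)
  have split: "qpoch p p N = qpoch p (p\<^sup>2) M * qpoch (p\<^sup>2) (p\<^sup>2) M"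
    unfolding N by (rule qpoch_even_split)
  have S: "?S * (\<Prod>j<N. p ^ j) = ?c"
    unfolding qKummer_sum_eq_coeff[OF assms(1)] by (simp add: coeff_pcompose_square N)
  have EO: "(\<Prod>j<N. p ^ j) = ?E * ?O"
    unfolding N by (rule prod_lessThan_even_split)
  have "?S * qpoch p p N * (?E * ?O) = ?c * qpoch (p\<^sup>2) (p\<^sup>2) M * qpoch p (p\<^sup>2) M"
    unfolding S[symmetric] EO split by (simp only: mult_ac)
  \<comment> \<open>The sign comes from the parameter \<open>- 1\<close> of the polynomial; the
    reversal below absorbs it.\<close>
  also have "\<dots> = ?E * qpoch (p ^ (N + 2)) (p\<^sup>2) M * ((- 1) ^ M * qpoch p (p\<^sup>2) M)"
    unfolding coeff_qbinom_poly_mult_qpoch prod_diff_eq_qpoch[OF N] by (simp only: mult_ac)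
  also have "\<dots> = qpoch (q * p) (p\<^sup>2) M * qpoch (p ^ (N + 2)) (p\<^sup>2) M * (?E * ?O)"
    unfolding qpoch_reverse_odd[OF N, symmetric] by (simp only: mult_ac)
  finally have "?S * qpoch p p N = qpoch (q * p) (p\<^sup>2) M * qpoch (p ^ (N + 2)) (p\<^sup>2) M"
    unfolding mult_right_cancel[OF nz] .
  then show ?thesis
    unfolding nonzero_eq_divide_eq[OF nz'] .
qed

end

section \<open>Roots of the cyclotomic polynomial\<close>

text \<open>An integer \<open>r\<close> is allowed so that differences of exponents are
  covered.\<close>

lemma cis_root_of_unity_eq_1:
  assumes "n > 0" "cis (2 * pi * real_of_int r / real n) = 1"
  shows "int n dvd r"
proof -
  have "cos (2 * pi * real_of_int r / real n) = 1"
    using assms(2) by (metis cis.sel(1) one_complex.sel(1))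
  then obtain k :: int where "2 * pi * real_of_int r / real n = real_of_int k * 2 * pi"
    by (auto simp: cos_one_2pi_int)
  then have "real_of_int r = real_of_int (k * int n)"
    using assms(1) by (simp add: field_simps)
  then show ?thesis
    by (metis dvd_triv_right of_int_eq_iff)
qed

definition primitive_roots :: "nat \<Rightarrow> complex set" where
  "primitive_roots n = (\<lambda>j. cis (2 * pi * real j / real n)) ` {j. 1 \<le> j \<and> j \<le> n \<and> coprime j n}"

lemma finite_primitive_roots: "finite (primitive_roots n)"
  unfolding primitive_roots_def by (rule finite_imageI, rule finite_subset[of _ "{..n}"]) auto

lemma primitive_root_power_eq_1_iff:
  assumes "n > 0" "z \<in> primitive_roots n"
  shows "z ^ m = 1 \<longleftrightarrow> n dvd m"
proof -
  obtain j where j: "coprime j n" "z = cis (2 * pi * real j / real n)"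
    using assms(2) by (auto simp: primitive_roots_def)
  have zm: "z ^ m = cis (2 * pi * real_of_int (int (j * m)) / real n)"
    by (simp add: j Complex.DeMoivre mult_ac)
  show ?thesis
  proof
    assume "z ^ m = 1"
    then have "int n dvd int (j * m)"
      using cis_root_of_unity_eq_1[OF assms(1)] zm by metis
    then have "n dvd j * m"
      by presburger
    then show "n dvd m"
      using j(1) by (simp add: coprime_commute coprime_dvd_mult_right_iff)
  next
    assume "n dvd m"
    then obtain l where "m = n * l" ..
    then have "2 * pi * real_of_int (int (j * m)) / real n = 2 * pi * real (j * l)"
      using assms(1) by (simp add: field_simps)
    then show "z ^ m = 1"
      unfolding zm by (metis Ints_of_nat cis_multiple_2pi)
  qed
qed

text \<open>Distinct indices give distinct roots, so all roots are simple and vanishing at each of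
  them will suffice for divisibility.\<close>

lemma cyclotomic_eq_prod_primitive_roots:
  assumes "n > 0"
  shows "cyclotomic n = (\<Prod>z\<in>primitive_roots n. [:- z, 1:])"
proof -
  have "inj_on (\<lambda>j. cis (2 * pi * real j / real n)) {j. 1 \<le> j \<and> j \<le> n \<and> coprime j n}"
  proof (rule inj_onI; clarify)
    fix i j assume ij: "1 \<le> i" "i \<le> n" "1 \<le> j" "j \<le> n"
      and "cis (2 * pi * real i / real n) = cis (2 * pi * real j / real n)"
    then have "cis (2 * pi * real i / real n - 2 * pi * real j / real n) = 1"
      by (simp flip: cis_divide)
    then have "cis (2 * pi * real_of_int (int i - int j) / real n) = 1"
      by (simp add: algebra_simps diff_divide_distrib)
    then have "int n dvd int i - int j"
      by (rule cis_root_of_unity_eq_1[OF assms])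
    moreover have "\<bar>int i - int j\<bar> < int n"
      using ij by auto
    ultimately show "i = j"
      using dvd_imp_le_int[of "int i - int j" "int n"] by auto
  qed
  then show ?thesis
    unfolding cyclotomic_def primitive_roots_def by (simp add: prod.reindex)
qed

section \<open>Evaluation of rational functions\<close>

text \<open>
  A single representation \<open>A / B\<close> has to serve all points of \<open>Z\<close>, since the congruence asks for
  one denominator that is nonzero at all roots at once.
\<close>
definition rf_evals :: "complex set \<Rightarrow> complex poly fract \<Rightarrow> (complex \<Rightarrow> complex) \<Rightarrow> bool" where
  "rf_evals Z x f \<longleftrightarrow>
    (\<exists>A B. B \<noteq> 0 \<and> x = Fract A B \<and> (\<forall>z\<in>Z. poly B z \<noteq> 0 \<and> f z = poly A z / poly B z))"

lemma rf_evals_qvar: "rf_evals Z qvar (\<lambda>z. z)"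
  unfolding rf_evals_def qvar_def by (intro exI[of _ "[:0, 1:]"] exI[of _ 1]) simp

lemma rf_evals_0: "rf_evals Z 0 (\<lambda>z. 0)"
  unfolding rf_evals_def by (intro exI[of _ 0] exI[of _ 1]) (simp add: fract_collapse)

lemma rf_evals_1: "rf_evals Z 1 (\<lambda>z. 1)"
  unfolding rf_evals_def by (rule exI[of _ 1], rule exI[of _ 1]) (simp add: fract_collapse)

lemma rf_evals_add:
  assumes "rf_evals Z x f" "rf_evals Z y g"
  shows "rf_evals Z (x + y) (\<lambda>z. f z + g z)"
proof -
  obtain A B C D where "B \<noteq> 0" "x = Fract A B" "\<forall>z\<in>Z. poly B z \<noteq> 0 \<and> f z = poly A z / poly B z"
    "D \<noteq> 0" "y = Fract C D" "\<forall>z\<in>Z. poly D z \<noteq> 0 \<and> g z = poly C z / poly D z"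
    using assms by (auto simp: rf_evals_def)
  then show ?thesis
    unfolding rf_evals_def
    by (intro exI[of _ "A * D + C * B"] exI[of _ "B * D"]) (simp add: add_frac_eq)
qed

lemma rf_evals_uminus:
  assumes "rf_evals Z x f"
  shows "rf_evals Z (- x) (\<lambda>z. - f z)"
proof -
  obtain A B where "B \<noteq> 0" "x = Fract A B" "\<forall>z\<in>Z. poly B z \<noteq> 0 \<and> f z = poly A z / poly B z"
    using assms by (auto simp: rf_evals_def)
  then show ?thesis
    unfolding rf_evals_def by (intro exI[of _ "- A"] exI[of _ B]) simp
qed

lemma rf_evals_diff:
  "rf_evals Z x f \<Longrightarrow> rf_evals Z y g \<Longrightarrow> rf_evals Z (x - y) (\<lambda>z. f z - g z)"
  using rf_evals_add[OF _ rf_evals_uminus, of Z x f y g] by simp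

lemma rf_evals_mult:
  assumes "rf_evals Z x f" "rf_evals Z y g"
  shows "rf_evals Z (x * y) (\<lambda>z. f z * g z)"
proof -
  obtain A B C D where "B \<noteq> 0" "x = Fract A B" "\<forall>z\<in>Z. poly B z \<noteq> 0 \<and> f z = poly A z / poly B z"
    "D \<noteq> 0" "y = Fract C D" "\<forall>z\<in>Z. poly D z \<noteq> 0 \<and> g z = poly C z / poly D z"
    using assms by (auto simp: rf_evals_def)
  then show ?thesis
    unfolding rf_evals_def by (intro exI[of _ "A * C"] exI[of _ "B * D"]) simp
qed

lemma rf_evals_divide:
  assumes "rf_evals Z x f" "rf_evals Z y g" "\<And>z. z \<in> Z \<Longrightarrow> g z \<noteq> 0" "Z \<noteq> {}"
  shows "rf_evals Z (x / y) (\<lambda>z. f z / g z)"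
proof -
  obtain A B C D where *: "B \<noteq> 0" "x = Fract A B" "\<forall>z\<in>Z. poly B z \<noteq> 0 \<and> f z = poly A z / poly B z"
    "D \<noteq> 0" "y = Fract C D" "\<forall>z\<in>Z. poly D z \<noteq> 0 \<and> g z = poly C z / poly D z"
    using assms by (auto simp: rf_evals_def)
  moreover have "\<forall>z\<in>Z. poly C z \<noteq> 0"
    using assms(3) *(6) by fastforce
  \<comment> \<open>A point of \<open>Z\<close> is what excludes the zero polynomial as new
    denominator.\<close>
  moreover from this have "C \<noteq> 0"
    using assms(4) by auto
  ultimately show ?thesis
    unfolding rf_evals_def by (intro exI[of _ "A * D"] exI[of _ "B * C"]) simp
qed

lemma rf_evals_power: "rf_evals Z x f \<Longrightarrow> rf_evals Z (x ^ k) (\<lambda>z. f z ^ k)"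
  by (induction k) (simp_all add: rf_evals_1 rf_evals_mult)

lemma rf_evals_sum:
  fixes k :: nat
  assumes "\<And>j. j < k \<Longrightarrow> rf_evals Z (x j) (f j)"
  shows "rf_evals Z (\<Sum>j<k. x j) (\<lambda>z. \<Sum>j<k. f j z)"
  using assms by (induction k) (simp_all add: rf_evals_0 rf_evals_add)

lemma rf_evals_qpoch:
  assumes "rf_evals Z x f" "rf_evals Z y g"
  shows "rf_evals Z (qpoch x y k) (\<lambda>z. qpoch (f z) (g z) k)"
proof (induction k)
  case (Suc k)
  have "rf_evals Z (qpoch x y k * (1 - x * y ^ k)) (\<lambda>z. qpoch (f z) (g z) k * (1 - f z * g z ^ k))"
    by (intro rf_evals_mult Suc rf_evals_diff rf_evals_1 rf_evals_power assms)
  then show ?case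
    by (simp add: qpoch_def)
qed (simp add: qpoch_def rf_evals_1)

section \<open>From equal values at the roots to congruence\<close>

lemma coprime_linear_poly:
  fixes B :: "complex poly"
  assumes "poly B z \<noteq> 0"
  shows "coprime B [:- z, 1:]"
proof -
  have "prime_elem [:- z, 1:]"
    by (rule prime_elem_linear_field_poly) simp
  moreover have "\<not> [:- z, 1:] dvd B"
    using assms by (simp add: poly_eq_0_iff_dvd)
  ultimately show ?thesis
    using prime_elem_imp_coprime[of "[:- z, 1:]" B] by (simp only: coprime_commute simp_thms)
qed

text \<open>Linear factors at distinct points are coprime, so separate divisibility by each gives
  divisibility by the product.\<close>

lemma prod_linear_dvd_poly:
  fixes A :: "complex poly"
  assumes "finite Z" "\<And>z. z \<in> Z \<Longrightarrow> poly A z = 0"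
  shows "(\<Prod>z\<in>Z. [:- z, 1:]) dvd A"
  using assms
proof (induction Z)
  case (insert w Z)
  have "coprime (\<Prod>z\<in>Z. [:- z, 1:]) [:- w, 1:]"
    using insert by (intro coprime_linear_poly) (auto simp: poly_prod)
  moreover have "[:- w, 1:] dvd A" "(\<Prod>z\<in>Z. [:- z, 1:]) dvd A"
    using insert by (auto simp: poly_eq_0_iff_dvd)
  ultimately show ?case
    using insert.hyps divides_mult[of "\<Prod>z\<in>Z. [:- z, 1:]" A "[:- w, 1:]"]
    by (simp only: prod.insert mult.commute simp_thms)
qed simp

text \<open>Reduces the congruence to an identity of complex numbers at each primitive root.\<close>

lemma cong_rf_cyclotomicI:
  assumes "n > 0" "rf_evals (primitive_roots n) x f" "rf_evals (primitive_roots n) y g"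
    and "\<And>z. z \<in> primitive_roots n \<Longrightarrow> f z = g z"
  shows "cong_rf (cyclotomic n) x y"
proof -
  obtain A B where AB: "B \<noteq> 0" "x - y = Fract A B"
    "\<forall>z\<in>primitive_roots n. poly B z \<noteq> 0 \<and> f z - g z = poly A z / poly B z"
    using rf_evals_diff[OF assms(2,3)] by (auto simp: rf_evals_def)
  have "poly A z = 0" if "z \<in> primitive_roots n" for z
    using AB(3) assms(4) that by fastforce
  then have "cyclotomic n dvd A"
    unfolding cyclotomic_eq_prod_primitive_roots[OF assms(1)]
    by (intro prod_linear_dvd_poly finite_primitive_roots)
  moreover have "coprime B (cyclotomic n)"
    unfolding cyclotomic_eq_prod_primitive_roots[OF assms(1)]
    using AB(3) by (intro prod_coprime_right coprime_linear_poly) auto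
  ultimately show ?thesis
    using AB unfolding cong_rf_def by blast
qed

section \<open>The congruence\<close>

text \<open>For odd \<open>n\<close>, 4 is invertible modulo \<open>n\<close>, so
  \<open>z ^ 4\<close> still has order \<open>n\<close>.\<close>

lemma primitive_root_power4_neq_1:
  assumes "odd n" "z \<in> primitive_roots n" "1 \<le> j" "j < n"
  shows "(z ^ 4) ^ j \<noteq> 1"
proof -
  have "coprime n (2 ^ 2)"
    unfolding coprime_power_right_iff using assms(1) by simp
  then have "coprime n 4"
    by simp
  then have "n dvd 4 * j \<longleftrightarrow> n dvd j"
    by (simp add: coprime_dvd_mult_right_iff)
  then have "\<not> n dvd 4 * j"
    using assms by (auto dest: dvd_imp_le)
  then show ?thesis
    using primitive_root_power_eq_1_iff[of n z] assms by (simp flip: power_mult)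
qed

lemma qpoch_power4_nonzero:
  assumes "odd n" "z \<in> primitive_roots n" "k < n"
  shows "qpoch (z ^ 4) (z ^ 4) k \<noteq> 0"
  using assms primitive_root_power4_neq_1 by (intro qpoch_nonzero) auto

lemma qpoch_eq_0:
  assumes "q * p ^ N = 1" "N < k"
  shows "qpoch q p k = 0"
  unfolding qpoch_def using assms by (intro prod_zero) (auto intro!: bexI[of _ N])

text \<open>The divisibility \<open>n dvd 4 * N + 1\<close> makes \<open>z\<close> the inverse of
  \<open>(z ^ 4) ^ N\<close>, so the terminating evaluation applies with \<open>q = z\<close> and
  \<open>p = z ^ 4\<close>.\<close>

lemma sum_at_primitive_root:
  assumes n: "odd n" and z: "z \<in> primitive_roots n" and N: "N < n" "n dvd 4 * N + 1"
  shows "(\<Sum>k<n. (qpoch z (z ^ 4) k)\<^sup>2 / (qpoch (z ^ 4) (z ^ 4) k)\<^sup>2 * (- z) ^ (3 * k))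
    = (if odd N then 0
       else qpoch (z ^ 5) (z ^ 8) (N div 2) * qpoch (z ^ 7) (z ^ 8) (N div 2) / qpoch (z ^ 4) (z ^ 4) N)"
proof -
  have "n > 0" using n by (rule odd_pos)
  then have "z ^ (4 * N + 1) = 1"
    using primitive_root_power_eq_1_iff z N(2) by blast
  then have zp: "z * (z ^ 4) ^ N = 1"
    by (simp add: power_mult)
  have p: "z ^ 4 \<noteq> 0"
    using zp by auto
  have order: "(z ^ 4) ^ j \<noteq> 1" if "1 \<le> j" "j \<le> N" for j
    using primitive_root_power4_neq_1[OF n z] that N(1) by simp
  have "(\<Sum>k<n. (qpoch z (z ^ 4) k)\<^sup>2 / (qpoch (z ^ 4) (z ^ 4) k)\<^sup>2 * (- z) ^ (3 * k))
      = (\<Sum>k\<le>N. (qpoch z (z ^ 4) k)\<^sup>2 / (qpoch (z ^ 4) (z ^ 4) k)\<^sup>2 * (- z) ^ (3 * k))"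
    \<comment> \<open>For \<open>k > N\<close> the numerator contains the vanishing factor
      \<open>1 - z * (z ^ 4) ^ N\<close>.\<close>
    using N(1) qpoch_eq_0[OF zp] by (intro sum.mono_neutral_right) auto
  also have "\<dots> = (if odd N then 0
       else qpoch (z ^ 5) (z ^ 8) (N div 2) * qpoch (z ^ 7) (z ^ 8) (N div 2) / qpoch (z ^ 4) (z ^ 4) N)"
  proof (cases "odd N")
    case True
    then show ?thesis
      using qKummer_sum_odd[OF p order zp refl] by simp
  next
    case False
    then have N2: "N = 2 * (N div 2)" by simp
    \<comment> \<open>This explains the 7 in the result: \<open>p ^ (N + 2)\<close> is
      \<open>z ^ 8\<close> divided by \<open>z\<close>.\<close>
    have "z * (z ^ 4) ^ (N + 2) = z * z ^ 7"
      using zp by (simp add: power_add mult.assoc[symmetric]) (simp add: eval_nat_numeral)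
    then have "(z ^ 4) ^ (N + 2) = z ^ 7"
      using p by simp
    moreover have "z * z ^ 4 = z ^ 5" "(z ^ 4)\<^sup>2 = z ^ 8"
      by (simp_all add: eval_nat_numeral)
    ultimately show ?thesis
      using qKummer_sum_even[OF p order zp refl N2] False by simp
  qed
  finally show ?thesis .
qed

lemma primitive_roots_nonempty: "n > 0 \<Longrightarrow> primitive_roots n \<noteq> {}"
  by (auto simp: primitive_roots_def intro!: exI[of _ 1])

theorem theorem3:
  fixes n :: nat
  assumes "odd n" and "n > 0"
  shows "cong_rf (cyclotomic n)
    (\<Sum>k<n. (qpoch qvar (qvar ^ 4) k)\<^sup>2 / (qpoch (qvar ^ 4) (qvar ^ 4) k)\<^sup>2 * (- qvar) ^ (3 * k))
    (if n mod 8 = 1 then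
       qpoch (qvar ^ 5) (qvar ^ 8) ((n - 1) div 8) * qpoch (qvar ^ 7) (qvar ^ 8) ((n - 1) div 8)
         / qpoch (qvar ^ 4) (qvar ^ 4) ((n - 1) div 4)
     else if n mod 8 = 3 then
       qpoch (qvar ^ 5) (qvar ^ 8) ((3 * n - 1) div 8) * qpoch (qvar ^ 7) (qvar ^ 8) ((3 * n - 1) div 8)
         / qpoch (qvar ^ 4) (qvar ^ 4) ((3 * n - 1) div 4)
     else 0)"
proof (rule cong_rf_cyclotomicI[OF assms(2)])
  let ?Z = "primitive_roots n"
  \<comment> \<open>One formula serves both nonzero cases: \<open>m = 4 * N + 1\<close> is
    \<open>n\<close> or \<open>3 * n\<close>.\<close>
  let ?g = "\<lambda>m z. qpoch (z ^ 5) (z ^ 8) ((m - 1) div 8) * qpoch (z ^ 7) (z ^ 8) ((m - 1) div 8)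
         / qpoch (z ^ 4) (z ^ 4) ((m - 1) div 4)"
  let ?rhs = "\<lambda>z. if n mod 8 = 1 then ?g n z else if n mod 8 = 3 then ?g (3 * n) z else 0"
  note nz = qpoch_power4_nonzero[OF assms(1)] primitive_roots_nonempty[OF assms(2)]
  show "rf_evals ?Z
      (\<Sum>k<n. (qpoch qvar (qvar ^ 4) k)\<^sup>2 / (qpoch (qvar ^ 4) (qvar ^ 4) k)\<^sup>2 * (- qvar) ^ (3 * k))
      (\<lambda>z. \<Sum>k<n. (qpoch z (z ^ 4) k)\<^sup>2 / (qpoch (z ^ 4) (z ^ 4) k)\<^sup>2 * (- z) ^ (3 * k))"
    by (intro rf_evals_sum rf_evals_mult rf_evals_divide rf_evals_power rf_evals_qpoch
        rf_evals_uminus rf_evals_qvar) (use nz in auto)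
  have g: "rf_evals ?Z
      (qpoch (qvar ^ 5) (qvar ^ 8) ((m - 1) div 8) * qpoch (qvar ^ 7) (qvar ^ 8) ((m - 1) div 8)
         / qpoch (qvar ^ 4) (qvar ^ 4) ((m - 1) div 4)) (?g m)" if "(m - 1) div 4 < n" for m
    by (intro rf_evals_mult rf_evals_divide rf_evals_power rf_evals_qpoch rf_evals_qvar)
      (use nz that in auto)
  \<comment> \<open>These bounds keep the denominators nonzero at every primitive root.\<close>
  have "(n - 1) div 4 < n" "(3 * n - 1) div 4 < n"
    using assms(2) by auto
  then show "rf_evals ?Z
    (if n mod 8 = 1 then
       qpoch (qvar ^ 5) (qvar ^ 8) ((n - 1) div 8) * qpoch (qvar ^ 7) (qvar ^ 8) ((n - 1) div 8)
         / qpoch (qvar ^ 4) (qvar ^ 4) ((n - 1) div 4)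
     else if n mod 8 = 3 then
       qpoch (qvar ^ 5) (qvar ^ 8) ((3 * n - 1) div 8) * qpoch (qvar ^ 7) (qvar ^ 8) ((3 * n - 1) div 8)
         / qpoch (qvar ^ 4) (qvar ^ 4) ((3 * n - 1) div 4)
     else 0) ?rhs"
    using g[of n] g[of "3 * n"] rf_evals_0 by (simp split: if_split)
  fix z assume z: "z \<in> ?Z"
  let ?S = "\<Sum>k<n. (qpoch z (z ^ 4) k)\<^sup>2 / (qpoch (z ^ 4) (z ^ 4) k)\<^sup>2 * (- z) ^ (3 * k)"
  \<comment> \<open>The index \<open>N\<close> solves \<open>4 * N + 1 = n\<close> for residues 1
    and 5, and \<open>4 * N + 1 = 3 * n\<close> for 3 and 7. It is even for 1 and 3 and odd for 5
    and 7, where the sum vanishes.\<close>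
  have "n mod 8 = 1 \<or> n mod 8 = 3 \<or> n mod 8 = 5 \<or> n mod 8 = 7"
    using assms(1) by presburger
  then consider "n mod 8 = 1" | "n mod 8 = 3" | "n mod 8 = 5" | "n mod 8 = 7"
    by blast
  then show "?S = ?rhs z"
  proof cases
    case 1
    then obtain k where "n = 8 * k + 1"
      using div_mult_mod_eq[of n 8] by (metis mult.commute)
    then have "2 * k < n" "4 * (2 * k) + 1 = n" "(n - 1) div 4 = 2 * k" "(n - 1) div 8 = k"
      by auto
    then show ?thesis
      using sum_at_primitive_root[OF assms(1) z, of "2 * k"] 1 by simp
  next
    case 2
    then obtain k where "n = 8 * k + 3"
      using div_mult_mod_eq[of n 8] by (metis mult.commute)
    then have "2 * (3 * k + 1) < n" "4 * (2 * (3 * k + 1)) + 1 = 3 * n" "(3 * n - 1) div 4 = 2 * (3 * k + 1)" "(3 * n - 1) div 8 = 3 * k + 1"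
      by auto
    then show ?thesis
      using sum_at_primitive_root[OF assms(1) z, of "2 * (3 * k + 1)"] 2 by simp
  next
    case 3
    then obtain k where "n = 8 * k + 5"
      using div_mult_mod_eq[of n 8] by (metis mult.commute)
    then have "2 * k + 1 < n" "4 * (2 * k + 1) + 1 = n"
      by auto
    then show ?thesis
      using sum_at_primitive_root[OF assms(1) z, of "2 * k + 1"] 3 by simp
  next
    case 4
    then obtain k where "n = 8 * k + 7"
      using div_mult_mod_eq[of n 8] by (metis mult.commute)
    then have "2 * (3 * k + 2) + 1 < n" "4 * (2 * (3 * k + 2) + 1) + 1 = 3 * n"
      by auto
    then show ?thesis
      using sum_at_primitive_root[OF assms(1) z, of "2 * (3 * k + 2) + 1"] 4 by simp
  qed
qed

end
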